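(* Let $n$ be a positive integer and let $f\colon X\to X$ be an $n$-expansive homeomorphism of a compact metric space $(X,d)$. If $f$ has the shadowing property, then $f$ has the limit shadowing property. If, in addition, $f$ is topologically mixing, then $f$ has the two-sided limit shadowing property.
   Context: Here $\mathbb{N}=\{1,2,\dots\}$. $n$-expansive: $f$ is $n$-expansive if there exists $c>0$ such that for every $x\in X$ the set $\Gamma(x,c)=\{y\in X : d(f^k(x),f^k(y))\le c \text{ for all } k\in\mathbb{Z}\}$ contains at most $n$ different points. Shadowing property: a sequence $(x_k)_{k\in\mathbb{Z}}\subset X$ is a $\delta$-pseudo-orbit if $d(f(x_k),x_{k+1})<\delta$ for all $k\in\mathbb{Z}$; it is $\varepsilon$-shadowed if there is $y\in X$ with $d(f^k(y),x_k)<\varepsilon$ for all $k\in\mathbb{Z}$. $f$ has the shadowing property if for every $\varepsilon>0$ there is $\delta>0$ such that every $\delta$-pseudo-orbit is $\varepsilon$-shadowed. Limit shadowing property: a sequence $(x_k)_{k\in\mathbb{N}}\subset X$ is a limit pseudo-orbit if $d(f(x_k),x_{k+1})\to0$ as $k\to\infty$; it is limit-shadowed if there is $y\in X$ with $d(f^k(y),x_k)\to 0$ as $k\to\infty$. $f$ has the limit shadowing property if every limit pseudo-orbit is limit-shadowed. Two-sided limit shadowing property: a sequence $(x_k)_{k\in\mathbb{Z}}\subset X$ is a two-sided limit pseudo-orbit if $d(f(x_k),x_{k+1})\to0$ as $|k|\to\infty$; it is two-sided limit shadowed if there is $y\in X$ with $d(f^k(y),x_k)\to 0$ as $|k|\to\infty$.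 $f$ has the two-sided limit shadowing property if every two-sided limit pseudo-orbit is two-sided limit shadowed. Topologically mixing: for any pair $(U,V)$ of non-empty open subsets of $X$ there is $k\in\mathbb{N}$ such that $f^j(U)\cap V\ne\emptyset$ for every $j\ge k$. *)

theory Defs
  imports "HOL-Analysis.Analysis"
begin

text \<open>The space is a set \<open>X\<close> in a type of class \<^class>\<open>metric_space\<close>, with
  the restricted metric; \<open>f\<close> only matters on \<open>X\<close>. Indices in \<open>{1, 2, \<dots>}\<close> are
  natural numbers \<open>k \<ge> 1\<close>.\<close>

text \<open>Meaningful when \<open>f\<close> is a bijection of \<open>X\<close> onto itself and \<open>x \<in> X\<close>.\<close>

definition int_iterate :: "'a set \<Rightarrow> ('a \<Rightarrow> 'a) \<Rightarrow> int \<Rightarrow> 'a \<Rightarrow> 'a" where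
  "int_iterate X f k =
     (if 0 \<le> k then f ^^ nat k else inv_into X f ^^ nat (- k))"

definition dyn_ball ::
    "'a::metric_space set \<Rightarrow> ('a \<Rightarrow> 'a) \<Rightarrow> 'a \<Rightarrow> real \<Rightarrow> 'a set" where
  "dyn_ball X f x c =
     {y \<in> X. \<forall>k. dist (int_iterate X f k x) (int_iterate X f k y) \<le> c}"

text \<open>Finiteness is stated because \<^const>\<open>card\<close> is 0 on infinite sets.\<close>

definition n_expansive :: "nat \<Rightarrow> 'a::metric_space set \<Rightarrow> ('a \<Rightarrow> 'a) \<Rightarrow> bool" where
  "n_expansive n X f \<longleftrightarrow>
     (\<exists>c>0. \<forall>x\<in>X. finite (dyn_ball X f x c) \<and> card (dyn_ball X f x c) \<le> n)"

definition pseudo_orbit ::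
    "'a::metric_space set \<Rightarrow> ('a \<Rightarrow> 'a) \<Rightarrow> real \<Rightarrow> (int \<Rightarrow> 'a) \<Rightarrow> bool" where
  "pseudo_orbit X f \<delta> x \<longleftrightarrow>
     (\<forall>k. x k \<in> X) \<and> (\<forall>k. dist (f (x k)) (x (k + 1)) < \<delta>)"

definition shadowed ::
    "'a::metric_space set \<Rightarrow> ('a \<Rightarrow> 'a) \<Rightarrow> real \<Rightarrow> (int \<Rightarrow> 'a) \<Rightarrow> bool" where
  "shadowed X f \<epsilon> x \<longleftrightarrow> (\<exists>y\<in>X. \<forall>k. dist (int_iterate X f k y) (x k) < \<epsilon>)"

definition shadowing :: "'a::metric_space set \<Rightarrow> ('a \<Rightarrow> 'a) \<Rightarrow> bool" where
  "shadowing X f \<longleftrightarrow>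
     (\<forall>\<epsilon>>0. \<exists>\<delta>>0. \<forall>x. pseudo_orbit X f \<delta> x \<longrightarrow> shadowed X f \<epsilon> x)"

definition limit_pseudo_orbit ::
    "'a::metric_space set \<Rightarrow> ('a \<Rightarrow> 'a) \<Rightarrow> (nat \<Rightarrow> 'a) \<Rightarrow> bool" where
  "limit_pseudo_orbit X f x \<longleftrightarrow>
     (\<forall>k\<ge>1. x k \<in> X) \<and> (\<lambda>k. dist (f (x k)) (x (k + 1))) \<longlonglongrightarrow> 0"

definition limit_shadowed ::
    "'a::metric_space set \<Rightarrow> ('a \<Rightarrow> 'a) \<Rightarrow> (nat \<Rightarrow> 'a) \<Rightarrow> bool" where
  "limit_shadowed X f x \<longleftrightarrow> (\<exists>y\<in>X. (\<lambda>k. dist ((f ^^ k) y) (x k)) \<longlonglongrightarrow> 0)"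

definition limit_shadowing :: "'a::metric_space set \<Rightarrow> ('a \<Rightarrow> 'a) \<Rightarrow> bool" where
  "limit_shadowing X f \<longleftrightarrow>
     (\<forall>x. limit_pseudo_orbit X f x \<longrightarrow> limit_shadowed X f x)"

text \<open>The filter \<open>filtercomap abs at_top\<close> on the integers expresses \<open>\<bar>k\<bar> \<rightarrow> \<infinity>\<close>.\<close>

definition two_sided_limit_pseudo_orbit ::
    "'a::metric_space set \<Rightarrow> ('a \<Rightarrow> 'a) \<Rightarrow> (int \<Rightarrow> 'a) \<Rightarrow> bool" where
  "two_sided_limit_pseudo_orbit X f x \<longleftrightarrow>
     (\<forall>k. x k \<in> X) \<and>
     ((\<lambda>k. dist (f (x k)) (x (k + 1))) \<longlongrightarrow> 0) (filtercomap abs at_top)"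

definition two_sided_limit_shadowed ::
    "'a::metric_space set \<Rightarrow> ('a \<Rightarrow> 'a) \<Rightarrow> (int \<Rightarrow> 'a) \<Rightarrow> bool" where
  "two_sided_limit_shadowed X f x \<longleftrightarrow>
     (\<exists>y\<in>X. ((\<lambda>k. dist (int_iterate X f k y) (x k)) \<longlongrightarrow> 0) (filtercomap abs at_top))"

definition two_sided_limit_shadowing ::
    "'a::metric_space set \<Rightarrow> ('a \<Rightarrow> 'a) \<Rightarrow> bool" where
  "two_sided_limit_shadowing X f \<longleftrightarrow>
     (\<forall>x. two_sided_limit_pseudo_orbit X f x \<longrightarrow> two_sided_limit_shadowed X f x)"

definition topologically_mixing ::
    "'a::topological_space set \<Rightarrow> ('a \<Rightarrow> 'a) \<Rightarrow> bool" where
  "topologically_mixing X f \<longleftrightarrow>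
     (\<forall>U V. openin (top_of_set X) U \<and> U \<noteq> {} \<and> openin (top_of_set X) V \<and> V \<noteq> {} \<longrightarrow>
        (\<exists>k\<ge>1. \<forall>j\<ge>k. (f ^^ j) ` U \<inter> V \<noteq> {}))"

end

theory Submission
  imports Defs
begin

text \<open>
  The proof rests on a rigidity property of limit pseudo-orbits
  (\<open>eventually_near_imp_asymptotic\<close> below): for a limit pseudo-orbit \<open>x\<close> there is
  \<open>\<epsilon> > 0\<close> such that every orbit which is eventually \<open>\<epsilon>\<close>-close to \<open>x\<close> is in fact
  asymptotic to \<open>x\<close>. Once this is known, limit shadowing follows by shadowing a tail of
  \<open>x\<close> with accuracy \<open>\<epsilon>\<close>. For the two-sided version the same property is used in both
  time directions, and topological mixing provides an orbit segment that joins the far past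
  of \<open>x\<close> to its far future with small jumps; shadowing the resulting pseudo-orbit gives an
  orbit eventually close to \<open>x\<close> in both directions, hence asymptotic to it in both.

  Rigidity has two ingredients, both coming from the finiteness of the sets
  \<open>\<Gamma>(z, c)\<close>. First, let \<open>b\<close> be a limit point of \<open>x\<close>. As \<open>\<Gamma>(b, c)\<close> is finite, \<open>b\<close> is
  isolated in it. If an orbit is eventually \<open>\<epsilon>\<close>-close to \<open>x\<close>, its limit points along the
  same times lie in \<open>\<Gamma>(b, \<epsilon>)\<close>, which for small \<open>\<epsilon>\<close> is just \<open>{b}\<close>; so the orbit comes
  arbitrarily close to \<open>x\<close> infinitely often. Secondly, suppose that an orbit stays
  \<open>c / 2\<close>-close to \<open>x\<close>, approaches it arbitrarily well infinitely often, but also is at a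
  distance \<open>\<ge> \<eta>\<close> infinitely often. At each time \<open>a\<close> of close approach one may switch from
  \<open>x\<close> to the orbit, which gives a pseudo-orbit. The points shadowing these infinitely many
  pseudo-orbits all lie in one set \<open>\<Gamma>(p, c)\<close>, yet two switching times with an
  \<open>\<eta>\<close>-separated time between them belong to different points, and this contradicts
  finiteness.
\<close>

lemma tendsto_if_dist_tendsto_0:
  fixes g h :: "'b \<Rightarrow> 'a::metric_space"
  assumes "(g \<longlongrightarrow> a) F" and "((\<lambda>m. dist (g m) (h m)) \<longlongrightarrow> 0) F"
  shows "(h \<longlongrightarrow> a) F"
proof (rule iffD2[OF tendsto_dist_iff], rule real_tendsto_sandwich[of "\<lambda>_. 0"])
  show "((\<lambda>m. dist (g m) (h m) + dist (g m) a) \<longlongrightarrow> 0) F"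
    using tendsto_add[OF assms(2) iffD1[OF tendsto_dist_iff assms(1)]] by simp
  show "\<forall>\<^sub>F m in F. dist (h m) a \<le> dist (g m) (h m) + dist (g m) a"
    by (intro always_eventually allI dist_triangle3)
qed simp_all

section \<open>Integer actions with shadowing and finite dynamical balls\<close>

text \<open>The dynamics enters as an action of the integers so that the backward statements
  are the forward ones for the reversed action \<open>\<lambda>k. \<phi> (- k)\<close>.\<close>

locale shadowing_action =
  fixes X :: "'a::metric_space set" and \<phi> :: "int \<Rightarrow> 'a \<Rightarrow> 'a" and c :: real
  assumes compact_space: "compact X"
    and in_space: "x \<in> X \<Longrightarrow> \<phi> k x \<in> X"
    and action_0: "x \<in> X \<Longrightarrow> \<phi> 0 x = x"
    and action_add: "x \<in> X \<Longrightarrow> \<phi> (j + k) x = \<phi> j (\<phi> k x)"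
    and continuous: "continuous_on X (\<phi> k)"
    and c_pos: "0 < c"
    and finite_ball: "x \<in> X \<Longrightarrow> finite {y \<in> X. \<forall>k. dist (\<phi> k x) (\<phi> k y) \<le> c}"
    and shadowing: "0 < \<epsilon> \<Longrightarrow> \<exists>\<delta>>0. \<forall>x. range x \<subseteq> X \<longrightarrow>
      (\<forall>k. dist (\<phi> 1 (x k)) (x (k + 1)) < \<delta>) \<longrightarrow> (\<exists>y\<in>X. \<forall>k. dist (\<phi> k y) (x k) < \<epsilon>)"
begin

lemma action_1: "x \<in> X \<Longrightarrow> \<phi> 1 (\<phi> k x) = \<phi> (k + 1) x"
  by (metis action_add add.commute)

lemma action_uminus: "x \<in> X \<Longrightarrow> \<phi> (- k) (\<phi> k x) = x"
  by (metis action_add action_0 ab_left_minus)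

text \<open>By uniform continuity of \<open>\<phi> (- s)\<close>, a small jump after \<open>\<phi> s\<close> is a small jump
  for the reversed dynamics.\<close>

lemma small_jump_reversed:
  assumes "0 < \<epsilon>"
  obtains \<delta> where "0 < \<delta>"
    "\<And>u v. u \<in> X \<Longrightarrow> v \<in> X \<Longrightarrow> dist (\<phi> s u) v < \<delta> \<Longrightarrow> dist (\<phi> (- s) v) u < \<epsilon>"
proof -
  have "uniformly_continuous_on X (\<phi> (- s))"
    by (rule compact_uniformly_continuous[OF continuous compact_space])
  then obtain \<delta> where "0 < \<delta>" and
    \<delta>: "\<forall>u\<in>X. \<forall>v\<in>X. dist v u < \<delta> \<longrightarrow> dist (\<phi> (- s) v) (\<phi> (- s) u) < \<epsilon>"
    using assms unfolding uniformly_continuous_on_def by meson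
  have "dist (\<phi> (- s) v) u < \<epsilon>" if "u \<in> X" "v \<in> X" "dist (\<phi> s u) v < \<delta>" for u v
  proof -
    have "dist (\<phi> (- s) v) (\<phi> (- s) (\<phi> s u)) < \<epsilon>"
      using \<delta>[rule_format, of "\<phi> s u" v] in_space[of u s] that by (simp only: dist_commute)
    then show ?thesis by (simp only: action_uminus[OF that(1)])
  qed
  then show ?thesis by (rule that[OF \<open>0 < \<delta>\<close>])
qed

text \<open>Reversing time turns a pseudo-orbit of the inverse into one of the original action,
  with jumps controlled by \<open>small_jump_reversed\<close>.\<close>

lemma reversed: "shadowing_action X (\<lambda>k. \<phi> (- k)) c"
proof
  show "\<phi> (- (j + k)) x = \<phi> (- j) (\<phi> (- k) x)" if "x \<in> X" for j k x
    using action_add[OF that, of "- j" "- k"] by (simp add: add.commute)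
next
  fix x assume "x \<in> X"
  have "dist (\<phi> k x) (\<phi> k y) \<le> c" if "\<forall>k. dist (\<phi> (- k) x) (\<phi> (- k) y) \<le> c" for y k
    using spec[OF that, of "- k"] by simp
  then show "finite {y \<in> X. \<forall>k. dist (\<phi> (- k) x) (\<phi> (- k) y) \<le> c}"
    by (intro finite_subset[OF _ finite_ball[OF \<open>x \<in> X\<close>]]) blast
next
  fix \<epsilon> :: real assume "0 < \<epsilon>"
  from shadowing[OF this] obtain \<delta> where "0 < \<delta>" and \<delta>: "\<And>x. range x \<subseteq> X \<Longrightarrow>
      (\<And>k. dist (\<phi> 1 (x k)) (x (k + 1)) < \<delta>) \<Longrightarrow> \<exists>y\<in>X. \<forall>k. dist (\<phi> k y) (x k) < \<epsilon>"
    by blast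
  obtain \<delta>' where "0 < \<delta>'" and \<delta>':
    "\<And>u v. u \<in> X \<Longrightarrow> v \<in> X \<Longrightarrow> dist (\<phi> (- 1) u) v < \<delta>' \<Longrightarrow> dist (\<phi> 1 v) u < \<delta>"
    using small_jump_reversed[OF \<open>0 < \<delta>\<close>, of "- 1"] unfolding minus_minus by blast
  have "\<exists>y\<in>X. \<forall>k. dist (\<phi> (- k) y) (x k) < \<epsilon>"
    if x: "range x \<subseteq> X" "\<forall>k. dist (\<phi> (- 1) (x k)) (x (k + 1)) < \<delta>'" for x
  proof -
    have "dist (\<phi> 1 (x (- k))) (x (- (k + 1))) < \<delta>" for k
      using \<delta>'[of "x (- (k + 1))" "x (- k)"] x(1) spec[OF x(2), of "- (k + 1)"]
      by (simp add: image_subset_iff)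
    moreover have "range (\<lambda>k. x (- k)) \<subseteq> X" using x(1) by auto
    ultimately obtain y where y: "y \<in> X" "\<And>k. dist (\<phi> k y) (x (- k)) < \<epsilon>"
      using \<delta>[of "\<lambda>k. x (- k)"] by blast
    have "dist (\<phi> (- k) y) (x k) < \<epsilon>" for k
      using y(2)[of "- k"] by simp
    then show ?thesis using y(1) by blast
  qed
  with \<open>0 < \<delta>'\<close>
  show "\<exists>\<delta>>0. \<forall>x. range x \<subseteq> X \<longrightarrow> (\<forall>k. dist (\<phi> (- 1) (x k)) (x (k + 1)) < \<delta>) \<longrightarrow>
      (\<exists>y\<in>X. \<forall>k. dist (\<phi> (- k) y) (x k) < \<epsilon>)"
    by (intro exI[of _ \<delta>'] conjI allI impI)
next
  show "\<phi> (- 0) x = x" if "x \<in> X" for x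
    using action_0[OF that] by simp
qed (rule compact_space in_space continuous c_pos; assumption?)+

section \<open>Orbits close to a limit pseudo-orbit\<close>

text \<open>A limit pseudo-orbit looks more and more like a true orbit along time windows of
  fixed length, so a limit point of it carries its whole orbit along, in both time
  directions.\<close>

lemma limit_pseudo_orbit_shift:
  assumes x: "range x \<subseteq> X"
    and lim: "((\<lambda>k. dist (\<phi> 1 (x k)) (x (k + 1))) \<longlongrightarrow> 0) at_top"
    and t: "filterlim t at_top F"
    and b: "b \<in> X" "((\<lambda>m. x (t m)) \<longlongrightarrow> b) F"
  shows "((\<lambda>m. x (t m + j)) \<longlongrightarrow> \<phi> j b) F"
proof (induction j rule: int_induct[where k = 0])
  case base
  then show ?case using b by (simp add: action_0)
next
  have xX: "x k \<in> X" for k using x by auto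
  have jump: "((\<lambda>m. dist (\<phi> 1 (x (t m + j))) (x (t m + j + 1))) \<longlongrightarrow> 0) F" for j
  proof (rule filterlim_compose[OF lim])
    show "filterlim (\<lambda>m. t m + j) at_top F"
      unfolding filterlim_at_top
    proof
      fix Z
      show "\<forall>\<^sub>F m in F. Z \<le> t m + j"
        using t[unfolded filterlim_at_top, rule_format, of "Z - j"] by eventually_elim simp
    qed
  qed
  have act: "((\<lambda>m. \<phi> i (g m)) \<longlongrightarrow> \<phi> i a) F" if "(g \<longlongrightarrow> a) F" "a \<in> X" "\<And>m. g m \<in> X" for i g a
    by (rule continuous_on_tendsto_compose[OF continuous that(1,2)]) (simp add: that(3))
  {
    case (step1 j)
    have "((\<lambda>m. \<phi> 1 (x (t m + j))) \<longlongrightarrow> \<phi> (j + 1) b) F"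
      using act[OF step1(2), of 1] xX b in_space action_1 by simp
    from tendsto_if_dist_tendsto_0[OF this jump] show ?case by (simp add: add.assoc)
  next
    case (step2 j)
    have "((\<lambda>m. \<phi> 1 (x (t m + (j - 1)))) \<longlongrightarrow> \<phi> j b) F"
      using tendsto_if_dist_tendsto_0[OF step2(2)] jump[of "j - 1"]
      by (simp add: dist_commute add.assoc)
    from act[OF this, of "- 1"] show ?case
      using xX b in_space action_uminus[of _ 1] action_add[of b "- 1" j] by simp
  }
qed

text \<open>Switching from \<open>x\<close> to the orbit of \<open>y\<close> at a time \<open>a\<close> of close approach gives a
  pseudo-orbit. If \<open>y\<close> and \<open>x\<close> were to separate infinitely often, infinitely many
  such \<open>a\<close> would lead to different shadowing points in a single dynamical ball.\<close>

lemma proximal_imp_asymptotic: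
  assumes x: "range x \<subseteq> X"
    and lim: "((\<lambda>k. dist (\<phi> 1 (x k)) (x (k + 1))) \<longlongrightarrow> 0) at_top"
    and y: "y \<in> X"
    and near: "\<forall>\<^sub>F k in at_top. dist (\<phi> k y) (x k) \<le> c / 2"
    and proximal: "\<And>\<eta>. 0 < \<eta> \<Longrightarrow> \<exists>\<^sub>F k in at_top. dist (\<phi> k y) (x k) < \<eta>"
  shows "((\<lambda>k. dist (\<phi> k y) (x k)) \<longlongrightarrow> 0) at_top"
proof (rule ccontr)
  assume "\<not> ?thesis"
  then obtain \<eta> where "0 < \<eta>" and "\<not> (\<forall>\<^sub>F k in at_top. dist (\<phi> k y) (x k) < \<eta>)"
    by (auto simp: tendsto_iff)
  then have far: "\<exists>s\<ge>N. \<eta> \<le> dist (\<phi> s y) (x s)" for N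
    by (auto simp: eventually_at_top_linorder not_less)
  have xX: "x k \<in> X" for k using x by auto
  \<comment> \<open>Orbits that \<open>\<alpha>\<close>-shadow two \<open>c / 2\<close>-close sequences are \<open>c\<close>-close, and one point
    cannot \<open>\<alpha>\<close>-shadow two points at distance \<open>\<ge> \<eta>\<close>.\<close>
  define \<alpha> where "\<alpha> = min (\<eta> / 2) (c / 4)"
  have "0 < \<alpha>" using \<open>0 < \<eta>\<close> c_pos by (simp add: \<alpha>_def)
  from shadowing[OF this] obtain \<delta> where "0 < \<delta>" and \<delta>: "\<And>x. range x \<subseteq> X \<Longrightarrow>
      (\<And>k. dist (\<phi> 1 (x k)) (x (k + 1)) < \<delta>) \<Longrightarrow> \<exists>y\<in>X. \<forall>k. dist (\<phi> k y) (x k) < \<alpha>"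
    by blast
  have "\<forall>\<^sub>F k in at_top. dist (\<phi> 1 (x k)) (x (k + 1)) < \<delta> / 2"
    using order_tendstoD(2)[OF lim, of "\<delta> / 2"] \<open>0 < \<delta>\<close> by simp
  from eventually_conj[OF near this] obtain K where K: "\<And>k. K \<le> k \<Longrightarrow> dist (\<phi> k y) (x k) \<le> c / 2"
      "\<And>k. K \<le> k \<Longrightarrow> dist (\<phi> 1 (x k)) (x (k + 1)) < \<delta> / 2"
    unfolding eventually_at_top_linorder by blast
  define C where "C = {a. K < a \<and> dist (\<phi> a y) (x a) < \<delta> / 2}"
  have "infinite C"
  proof
    assume "finite C"
    obtain a where "a > Max (insert K C)" "dist (\<phi> a y) (x a) < \<delta> / 2"
      using proximal[of "\<delta> / 2"] \<open>0 < \<delta>\<close>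
      by (auto simp: frequently_def eventually_at_top_dense)
    then show False using \<open>finite C\<close> by (auto simp: C_def)
  qed
  \<comment> \<open>Before time \<open>K\<close> the jumps of \<open>x\<close> may be large, so the past is replaced by the
    backward orbit of \<open>x K\<close>.\<close>
  define q where "q a k = (if k < K then \<phi> (k - K) (x K) else if k < a then x k else \<phi> k y)" for a k
  have "\<exists>p\<in>X. \<forall>k. dist (\<phi> k p) (q a k) < \<alpha>" if "a \<in> C" for a
  proof (rule \<delta>)
    show "range (q a) \<subseteq> X" using xX y in_space by (auto simp: q_def)
    have a: "K < a" "dist (\<phi> a y) (x a) < \<delta> / 2" using that by (auto simp: C_def)
    show "dist (\<phi> 1 (q a k)) (q a (k + 1)) < \<delta>" for k
    proof -
      consider "k < K" | "K \<le> k" "k + 1 < a" | "K \<le> k" "k + 1 = a" | "a \<le> k" by linarith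
      then show ?thesis
      proof cases
        case 1
        then have "q a (k + 1) = \<phi> (k + 1 - K) (x K)"
          using a xX action_0 by (cases "k + 1 = K") (auto simp: q_def)
        then show ?thesis using 1 xX action_1[of "x K" "k - K"] \<open>0 < \<delta>\<close>
          by (simp add: q_def algebra_simps)
      next
        case 2
        then show ?thesis using K(2)[of k] \<open>0 < \<delta>\<close> by (simp add: q_def)
      next
        case 3
        have "dist (\<phi> 1 (x k)) (\<phi> a y) \<le> dist (\<phi> 1 (x k)) (x a) + dist (\<phi> a y) (x a)"
          by (rule dist_triangle2)
        then show ?thesis using 3 K(2)[of k] a by (auto simp: q_def)
      next
        case 4
        then show ?thesis using a y action_1 \<open>0 < \<delta>\<close> by (simp add: q_def)
      qed
    qed
  qed
  then obtain p where p: "\<And>a. a \<in> C \<Longrightarrow> p a \<in> X" "\<And>a k. a \<in> C \<Longrightarrow> dist (\<phi> k (p a)) (q a k) < \<alpha>"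
    by metis
  obtain a0 where "a0 \<in> C" using \<open>infinite C\<close> by (metis ex_in_conv finite.emptyI)
  have "p ` C \<subseteq> {z \<in> X. \<forall>k. dist (\<phi> k (p a0)) (\<phi> k z) \<le> c}"
  proof clarsimp
    fix a assume "a \<in> C"
    have "dist (\<phi> k (p a0)) (\<phi> k (p a)) \<le> c" for k
    proof -
      have "dist (q a0 k) (q a k) \<le> c / 2"
        using K(1)[of k] c_pos by (auto simp: q_def dist_commute)
      moreover have "dist (\<phi> k (p a0)) (\<phi> k (p a))
          \<le> dist (\<phi> k (p a0)) (q a0 k) + dist (q a0 k) (q a k) + dist (\<phi> k (p a)) (q a k)"
        by metric
      ultimately show ?thesis
        using p(2)[OF \<open>a \<in> C\<close>, of k] p(2)[OF \<open>a0 \<in> C\<close>, of k] unfolding \<alpha>_def by linarith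
    qed
    then show "p a \<in> X \<and> (\<forall>k. dist (\<phi> k (p a0)) (\<phi> k (p a)) \<le> c)" using p(1) \<open>a \<in> C\<close> by blast
  qed
  then have "finite (p ` C)"
    using finite_ball[OF p(1)[OF \<open>a0 \<in> C\<close>]] finite_subset by blast
  from pigeonhole_infinite[OF \<open>infinite C\<close> this]
  obtain a1 where "a1 \<in> C" and inf: "infinite {a \<in> C. p a = p a1}" by blast
  obtain s where s: "a1 \<le> s" "\<eta> \<le> dist (\<phi> s y) (x s)" using far by blast
  have "\<not> {a \<in> C. p a = p a1} \<subseteq> {K..s}" using inf finite_subset by blast
  then obtain a2 where "a2 \<in> {a \<in> C. p a = p a1}" "a2 \<notin> {K..s}" by blast
  then have "a2 \<in> C" "p a2 = p a1" "s < a2" by (auto simp: C_def)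
  \<comment> \<open>At the separated time \<open>s\<close> one pseudo-orbit has already switched and the other has not.\<close>
  have "K < a1" using \<open>a1 \<in> C\<close> by (simp add: C_def)
  then have "q a1 s = \<phi> s y" "q a2 s = x s"
    using s(1) \<open>s < a2\<close> by (simp_all add: q_def)
  then have "dist (\<phi> s (p a1)) (\<phi> s y) < \<alpha>" "dist (\<phi> s (p a1)) (x s) < \<alpha>"
    using p(2)[OF \<open>a1 \<in> C\<close>, of s] p(2)[OF \<open>a2 \<in> C\<close>, of s] \<open>p a2 = p a1\<close> by simp_all
  then have "dist (\<phi> s y) (x s) < 2 * \<alpha>"
    using dist_triangle3[of "\<phi> s y" "x s" "\<phi> s (p a1)"] by linarith
  then show False using s(2) unfolding \<alpha>_def by linarith
qed

text \<open>A limit point \<open>b\<close> of \<open>x\<close> is isolated in its finite dynamical ball. Taking \<open>\<epsilon>\<close>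
  below the isolation radius forces any orbit that is eventually \<open>\<epsilon>\<close>-close to \<open>x\<close> to
  accumulate at \<open>b\<close> at the same times as \<open>x\<close> does.\<close>

lemma eventually_near_imp_asymptotic:
  assumes x: "range x \<subseteq> X"
    and lim: "((\<lambda>k. dist (\<phi> 1 (x k)) (x (k + 1))) \<longlongrightarrow> 0) at_top"
  obtains \<epsilon> where "0 < \<epsilon>"
    "\<And>y. y \<in> X \<Longrightarrow> \<forall>\<^sub>F k in at_top. dist (\<phi> k y) (x k) < \<epsilon> \<Longrightarrow>
      ((\<lambda>k. dist (\<phi> k y) (x k)) \<longlongrightarrow> 0) at_top"
proof -
  have seq: "seq_compact X"
    using compact_space compact_eq_seq_compact_metric by blast
  have int_lim: "filterlim (\<lambda>m. int (r m)) at_top sequentially" if "strict_mono r" for r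
    using filterlim_compose[OF filterlim_int_sequentially filterlim_subseq[OF that]] .
  obtain b r where b: "b \<in> X" and r: "strict_mono r" "(\<lambda>m. x (int (r m))) \<longlonglongrightarrow> b"
    using seq_compactE[OF seq, of "\<lambda>m. x (int m)"] x by (auto simp: comp_def image_subset_iff)
  from finite_set_avoid[OF finite_ball[OF b], of b]
  obtain \<rho> where "0 < \<rho>"
    and \<rho>: "\<And>a. a \<in> X \<Longrightarrow> (\<And>k. dist (\<phi> k b) (\<phi> k a) \<le> c) \<Longrightarrow> dist b a < \<rho> \<Longrightarrow> a = b"
    by fastforce
  define \<epsilon> where "\<epsilon> = min (\<rho> / 2) (c / 2)"
  have "0 < \<epsilon>" using \<open>0 < \<rho>\<close> c_pos by (simp add: \<epsilon>_def)
  moreover have "((\<lambda>k. dist (\<phi> k y) (x k)) \<longlongrightarrow> 0) at_top"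
    if y: "y \<in> X" and near: "\<forall>\<^sub>F k in at_top. dist (\<phi> k y) (x k) < \<epsilon>" for y
  proof -
    obtain a r' where a: "a \<in> X" and r': "strict_mono r'" "(\<lambda>m. \<phi> (int (r (r' m))) y) \<longlonglongrightarrow> a"
      using seq_compactE[OF seq, of "\<lambda>m. \<phi> (int (r m)) y"] y in_space by (auto simp: comp_def)
    define t where "t m = int (r (r' m))" for m
    have t: "filterlim t at_top sequentially"
      using int_lim[OF strict_mono_o[OF r(1) r'(1)]] by (simp add: t_def[abs_def] comp_def)
    have tb: "(\<lambda>m. x (t m)) \<longlonglongrightarrow> b"
      using LIMSEQ_subseq_LIMSEQ[OF r(2) r'(1)] by (simp add: t_def comp_def)
    have ta: "(\<lambda>m. \<phi> (t m) y) \<longlonglongrightarrow> a" using r'(2) by (simp add: t_def)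
    have le: "dist (\<phi> j a) (\<phi> j b) \<le> \<epsilon>" for j
    proof (rule tendsto_upperbound)
      have "(\<lambda>m. \<phi> (t m + j) y) \<longlonglongrightarrow> \<phi> j a"
        using limit_pseudo_orbit_shift[of "\<lambda>k. \<phi> k y", OF _ _ t a ta] y
        by (auto simp: in_space action_1 image_subset_iff)
      then show "(\<lambda>m. dist (\<phi> (t m + j) y) (x (t m + j))) \<longlonglongrightarrow> dist (\<phi> j a) (\<phi> j b)"
        using limit_pseudo_orbit_shift[OF x lim t b tb] by (rule tendsto_dist)
      obtain K where K: "\<And>k. K \<le> k \<Longrightarrow> dist (\<phi> k y) (x k) < \<epsilon>"
        using near by (auto simp: eventually_at_top_linorder)
      have "\<forall>\<^sub>F m in sequentially. K - j \<le> t m"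
        using t by (auto simp: filterlim_at_top)
      then show "\<forall>\<^sub>F m in sequentially. dist (\<phi> (t m + j) y) (x (t m + j)) \<le> \<epsilon>"
        by eventually_elim (use K in \<open>simp add: less_imp_le\<close>)
    qed simp
    have "a = b"
    proof (rule \<rho>[OF a])
      show "dist (\<phi> k b) (\<phi> k a) \<le> c" for k
        using le[of k] c_pos unfolding \<epsilon>_def by (simp add: dist_commute)
      show "dist b a < \<rho>"
        using le[of 0] \<open>0 < \<rho>\<close> unfolding \<epsilon>_def by (simp add: dist_commute action_0 a b)
    qed
    show ?thesis
    proof (rule proximal_imp_asymptotic[OF x lim y])
      show "\<forall>\<^sub>F k in at_top. dist (\<phi> k y) (x k) \<le> c / 2"
        using near by eventually_elim (simp add: \<epsilon>_def)
      fix \<eta> :: real assume "0 < \<eta>"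
      have "(\<lambda>m. dist (\<phi> (t m) y) (x (t m))) \<longlonglongrightarrow> 0"
        using tendsto_dist[OF ta tb] \<open>a = b\<close> by simp
      then have "\<forall>\<^sub>F m in sequentially. dist (\<phi> (t m) y) (x (t m)) < \<eta>"
        using \<open>0 < \<eta>\<close> by (auto simp: tendsto_iff)
      then have "\<exists>\<^sub>F m in sequentially. dist (\<phi> (t m) y) (x (t m)) < \<eta>"
        by (simp add: eventually_frequently)
      then show "\<exists>\<^sub>F k in at_top. dist (\<phi> k y) (x k) < \<eta>"
        using eventually_compose_filterlim[OF _ t] unfolding frequently_def by blast
    qed
  qed
  ultimately show ?thesis using that by blast
qed

section \<open>Limit shadowing of integer actions\<close>

theorem limit_shadowing_at_top:
  assumes x: "range x \<subseteq> X"
    and lim: "((\<lambda>k. dist (\<phi> 1 (x k)) (x (k + 1))) \<longlongrightarrow> 0) at_top"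
  shows "\<exists>y\<in>X. ((\<lambda>k. dist (\<phi> k y) (x k)) \<longlongrightarrow> 0) at_top"
proof -
  have xX: "x k \<in> X" for k using x by auto
  obtain \<epsilon> where "0 < \<epsilon>" and \<epsilon>: "\<And>y. y \<in> X \<Longrightarrow> \<forall>\<^sub>F k in at_top. dist (\<phi> k y) (x k) < \<epsilon> \<Longrightarrow>
      ((\<lambda>k. dist (\<phi> k y) (x k)) \<longlongrightarrow> 0) at_top"
    using eventually_near_imp_asymptotic[OF x lim] by blast
  from shadowing[OF \<open>0 < \<epsilon>\<close>] obtain \<delta> where "0 < \<delta>" and \<delta>: "\<And>x. range x \<subseteq> X \<Longrightarrow>
      (\<And>k. dist (\<phi> 1 (x k)) (x (k + 1)) < \<delta>) \<Longrightarrow> \<exists>y\<in>X. \<forall>k. dist (\<phi> k y) (x k) < \<epsilon>"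
    by blast
  have "\<forall>\<^sub>F k in at_top. dist (\<phi> 1 (x k)) (x (k + 1)) < \<delta>"
    using lim \<open>0 < \<delta>\<close> by (auto simp: tendsto_iff)
  then obtain K where K: "\<And>k. K \<le> k \<Longrightarrow> dist (\<phi> 1 (x k)) (x (k + 1)) < \<delta>"
    by (auto simp: eventually_at_top_linorder)
  define q where "q k = (if k < K then \<phi> (k - K) (x K) else x k)" for k
  have "\<exists>y\<in>X. \<forall>k. dist (\<phi> k y) (q k) < \<epsilon>"
  proof (rule \<delta>)
    show "range q \<subseteq> X" using xX in_space by (auto simp: q_def)
    show "dist (\<phi> 1 (q k)) (q (k + 1)) < \<delta>" for k
    proof (cases "k < K")
      case True
      then have "q (k + 1) = \<phi> (k + 1 - K) (x K)"
        using xX action_0 by (cases "k + 1 = K") (auto simp: q_def)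
      then show ?thesis using True xX action_1[of "x K" "k - K"] \<open>0 < \<delta>\<close>
        by (simp add: q_def algebra_simps)
    qed (use K in \<open>simp add: q_def\<close>)
  qed
  then obtain y where y: "y \<in> X" "\<And>k. dist (\<phi> k y) (q k) < \<epsilon>" by blast
  have "dist (\<phi> k y) (x k) < \<epsilon>" if "K \<le> k" for k
    using y(2)[of k] that by (simp add: q_def)
  then have "\<forall>\<^sub>F k in at_top. dist (\<phi> k y) (x k) < \<epsilon>"
    by (auto simp: eventually_at_top_linorder)
  from \<epsilon>[OF y(1) this] y(1) show ?thesis by blast
qed

text \<open>The time available for the connecting segment and its target \<open>x M\<close> change together.
  Letting \<open>M\<close> run through times at which \<open>x\<close> converges to a point \<open>b\<close> makes a fixed
  neighbourhood of \<open>b\<close> the target, so that a single waiting time from mixing suffices.\<close>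

lemma connecting_segment:
  assumes mixing: "\<And>U V. \<lbrakk>openin (top_of_set X) U; U \<noteq> {}; openin (top_of_set X) V; V \<noteq> {}\<rbrakk> \<Longrightarrow>
      \<exists>J. \<forall>j\<ge>J. \<phi> j ` U \<inter> V \<noteq> {}"
    and x: "range x \<subseteq> X" and "u \<in> X" and "0 < \<delta>"
  obtains M p where "N \<le> M" "p \<in> X" "dist u p < \<delta>" "dist (\<phi> (M + d) p) (x M) < \<delta>"
proof -
  have xX: "x k \<in> X" for k using x by auto
  have "seq_compact X"
    using compact_space compact_eq_seq_compact_metric by blast
  then obtain b r where b: "b \<in> X" and r: "strict_mono r" "(\<lambda>m. x (int (r m))) \<longlonglongrightarrow> b"
    using seq_compactE[of X "\<lambda>m. x (int m)"] xX by (auto simp: comp_def)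
  have "\<exists>J. \<forall>j\<ge>J. \<phi> j ` (X \<inter> ball u \<delta>) \<inter> (X \<inter> ball b (\<delta> / 2)) \<noteq> {}"
  proof (rule mixing)
    show "X \<inter> ball u \<delta> \<noteq> {}" "X \<inter> ball b (\<delta> / 2) \<noteq> {}"
      using assms b centre_in_ball[of u \<delta>] centre_in_ball[of b "\<delta> / 2"] by auto
  qed (simp_all add: openin_open_Int)
  then obtain J where J: "\<And>j. J \<le> j \<Longrightarrow> \<phi> j ` (X \<inter> ball u \<delta>) \<inter> (X \<inter> ball b (\<delta> / 2)) \<noteq> {}"
    by blast
  have "filterlim (\<lambda>m. int (r m)) at_top sequentially"
    using filterlim_compose[OF filterlim_int_sequentially filterlim_subseq[OF r(1)]] .
  then have "\<forall>\<^sub>F m in sequentially. max N (J - d) \<le> int (r m)"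
    unfolding filterlim_at_top by blast
  moreover have "\<forall>\<^sub>F m in sequentially. dist (x (int (r m))) b < \<delta> / 2"
    using tendstoD[OF r(2), of "\<delta> / 2"] \<open>0 < \<delta>\<close> by simp
  ultimately have "\<forall>\<^sub>F m in sequentially. max N (J - d) \<le> int (r m) \<and> dist (x (int (r m))) b < \<delta> / 2"
    by (rule eventually_conj)
  then obtain M where M: "N \<le> M" "J \<le> M + d" "dist (x M) b < \<delta> / 2"
    by (fastforce simp: eventually_sequentially)
  obtain p where p: "p \<in> X" "dist u p < \<delta>" "dist b (\<phi> (M + d) p) < \<delta> / 2"
    using J[OF M(2)] by auto
  have "dist (\<phi> (M + d) p) (x M) \<le> dist b (\<phi> (M + d) p) + dist (x M) b"
    by metric
  then show ?thesis using that M p by fastforce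
qed

theorem two_sided_limit_shadowing_if_mixing:
  assumes mixing: "\<And>U V. \<lbrakk>openin (top_of_set X) U; U \<noteq> {}; openin (top_of_set X) V; V \<noteq> {}\<rbrakk> \<Longrightarrow>
      \<exists>J. \<forall>j\<ge>J. \<phi> j ` U \<inter> V \<noteq> {}"
    and x: "range x \<subseteq> X"
    and lim_top: "((\<lambda>k. dist (\<phi> 1 (x k)) (x (k + 1))) \<longlongrightarrow> 0) at_top"
    and lim_bot: "((\<lambda>k. dist (\<phi> 1 (x k)) (x (k + 1))) \<longlongrightarrow> 0) at_bot"
  shows "\<exists>y\<in>X. ((\<lambda>k. dist (\<phi> k y) (x k)) \<longlongrightarrow> 0) at_top \<and>
    ((\<lambda>k. dist (\<phi> k y) (x k)) \<longlongrightarrow> 0) at_bot"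
proof -
  interpret rev: shadowing_action X "\<lambda>k. \<phi> (- k)" c by (rule reversed)
  have xX: "x k \<in> X" for k using x by auto
  have lim_rev: "((\<lambda>k. dist (\<phi> (- 1) (x (- k))) (x (- (k + 1)))) \<longlongrightarrow> 0) at_top"
  proof (rule tendstoI)
    fix e :: real assume "0 < e"
    then obtain d where "0 < d" and d:
      "\<And>u v. u \<in> X \<Longrightarrow> v \<in> X \<Longrightarrow> dist (\<phi> 1 u) v < d \<Longrightarrow> dist (\<phi> (- 1) v) u < e"
      using small_jump_reversed[of e 1] by blast
    have "\<forall>\<^sub>F k in at_bot. dist (\<phi> 1 (x k)) (x (k + 1)) < d"
      using lim_bot \<open>0 < d\<close> by (auto simp: tendsto_iff)
    then obtain K where K: "\<And>k. k \<le> K \<Longrightarrow> dist (\<phi> 1 (x k)) (x (k + 1)) < d"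
      by (auto simp: eventually_at_bot_linorder)
    have "dist (\<phi> (- 1) (x (- k))) (x (- (k + 1))) < e" if "- K \<le> k" for k
      using d[OF xX xX, of "- (k + 1)" "- k"] K[of "- (k + 1)"] that by simp
    then show "\<forall>\<^sub>F k in at_top. dist (dist (\<phi> (- 1) (x (- k))) (x (- (k + 1)))) 0 < e"
      by (auto simp: eventually_at_top_linorder)
  qed
  obtain \<epsilon>1 where "0 < \<epsilon>1" and \<epsilon>1: "\<And>y. y \<in> X \<Longrightarrow> \<forall>\<^sub>F k in at_top. dist (\<phi> k y) (x k) < \<epsilon>1 \<Longrightarrow>
      ((\<lambda>k. dist (\<phi> k y) (x k)) \<longlongrightarrow> 0) at_top"
    using eventually_near_imp_asymptotic[OF x lim_top] by blast
  have "range (\<lambda>k. x (- k)) \<subseteq> X" using xX by auto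
  from rev.eventually_near_imp_asymptotic[OF this lim_rev]
  obtain \<epsilon>2 where "0 < \<epsilon>2" and \<epsilon>2:
    "\<And>y. y \<in> X \<Longrightarrow> \<forall>\<^sub>F k in at_top. dist (\<phi> (- k) y) (x (- k)) < \<epsilon>2 \<Longrightarrow>
      ((\<lambda>k. dist (\<phi> (- k) y) (x (- k))) \<longlongrightarrow> 0) at_top" by blast
  have "0 < min \<epsilon>1 \<epsilon>2" using \<open>0 < \<epsilon>1\<close> \<open>0 < \<epsilon>2\<close> by simp
  from shadowing[OF this] obtain \<delta> where "0 < \<delta>" and \<delta>: "\<And>x. range x \<subseteq> X \<Longrightarrow>
      (\<And>k. dist (\<phi> 1 (x k)) (x (k + 1)) < \<delta>) \<Longrightarrow> \<exists>y\<in>X. \<forall>k. dist (\<phi> k y) (x k) < min \<epsilon>1 \<epsilon>2"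
    by blast
  have "\<forall>\<^sub>F k in at_top. dist (\<phi> 1 (x k)) (x (k + 1)) < \<delta>"
    "\<forall>\<^sub>F k in at_bot. dist (\<phi> 1 (x k)) (x (k + 1)) < \<delta>"
    using lim_top lim_bot \<open>0 < \<delta>\<close> by (auto simp: tendsto_iff)
  then obtain N1 N2 where N12: "\<And>k. N1 \<le> k \<Longrightarrow> dist (\<phi> 1 (x k)) (x (k + 1)) < \<delta>"
    "\<And>k. k \<le> N2 \<Longrightarrow> dist (\<phi> 1 (x k)) (x (k + 1)) < \<delta>"
    by (auto simp: eventually_at_top_linorder eventually_at_bot_linorder)
  define N where "N = max 1 (max N1 (- N2))"
  have N: "1 \<le> N" "\<And>k. N \<le> k \<Longrightarrow> dist (\<phi> 1 (x k)) (x (k + 1)) < \<delta>"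
    "\<And>k. k \<le> - N \<Longrightarrow> dist (\<phi> 1 (x k)) (x (k + 1)) < \<delta>"
    using N12 by (auto simp: N_def)
  obtain M p where M: "N \<le> M" and p: "p \<in> X" "dist (\<phi> 1 (x (- N))) p < \<delta>"
      "dist (\<phi> (M + (N - 1)) p) (x M) < \<delta>"
    by (rule connecting_segment[OF mixing x in_space[OF xX] \<open>0 < \<delta>\<close>])
  define q where "q k = (if k \<le> - N then x k else if k < M then \<phi> (k + (N - 1)) p else x k)" for k
  have "\<exists>y\<in>X. \<forall>k. dist (\<phi> k y) (q k) < min \<epsilon>1 \<epsilon>2"
  proof (rule \<delta>)
    show "range q \<subseteq> X" using xX in_space p by (auto simp: q_def)
    show "dist (\<phi> 1 (q k)) (q (k + 1)) < \<delta>" for k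
    proof -
      consider "k < - N" | "k = - N" | "- N < k" "k + 1 < M" | "k + 1 = M" | "M \<le> k" by linarith
      then show ?thesis
      proof cases
        case 1
        then show ?thesis using N(3)[of k] by (simp add: q_def)
      next
        case 2
        then show ?thesis using p N(1) M by (simp add: q_def action_0)
      next
        case 3
        then show ?thesis using p \<open>0 < \<delta>\<close> action_1[of p "k + (N - 1)"]
          by (simp add: q_def algebra_simps)
      next
        case 4
        then have q: "q k = \<phi> (k + (N - 1)) p" "q (k + 1) = x M"
          using N(1) M by (auto simp: q_def)
        have "\<phi> (k + (N - 1) + 1) p = \<phi> (M + (N - 1)) p"
          by (rule arg_cong[of _ _ "\<lambda>j. \<phi> j p"]) (use 4 in simp)
        then show ?thesis using p(3) unfolding q action_1[OF p(1)] by simp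
      next
        case 5
        then show ?thesis using N(2)[of k] N(1) M by (simp add: q_def)
      qed
    qed
  qed
  then obtain y where y: "y \<in> X" "\<And>k. dist (\<phi> k y) (q k) < min \<epsilon>1 \<epsilon>2" by blast
  have "\<forall>k\<ge>M. dist (\<phi> k y) (x k) < \<epsilon>1"
    using y(2) N(1) M by (force simp: q_def split: if_splits)
  then have top: "((\<lambda>k. dist (\<phi> k y) (x k)) \<longlongrightarrow> 0) at_top"
    using \<epsilon>1[OF y(1)] by (auto simp: eventually_at_top_linorder)
  have "dist (\<phi> (- k) y) (x (- k)) < \<epsilon>2" if "N \<le> k" for k
    using y(2)[of "- k"] that by (simp add: q_def)
  then have "((\<lambda>k. dist (\<phi> (- k) y) (x (- k))) \<longlongrightarrow> 0) at_top"
    using \<epsilon>2[OF y(1)] by (auto simp: eventually_at_top_linorder)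
  then have "((\<lambda>k. dist (\<phi> k y) (x k)) \<longlongrightarrow> 0) at_bot"
    unfolding at_bot_mirror filterlim_filtermap .
  with top y(1) show ?thesis by blast
qed

end

section \<open>The iterates of a homeomorphism\<close>

lemma shadowing_action_int_iterate:
  assumes "compact X" and homeo: "homeomorphism X X f g"
    and "0 < c" and "\<And>x. x \<in> X \<Longrightarrow> finite (dyn_ball X f x c)"
    and "shadowing X f"
  shows "shadowing_action X (int_iterate X f) c"
proof -
  have f: "continuous_on X f" "f ` X = X" "inj_on f X"
    using homeo by (auto simp: homeomorphism_def intro: inj_on_inverseI[of X g f])
  define h where "h = inv_into X f"
  have hf: "h (f x) = x" "f (h x) = x" "h x \<in> X" "f x \<in> X" if "x \<in> X" for x
    using that f unfolding h_def
    by (simp_all add: f_inv_into_f inv_into_into) blast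
  have "h x = g x" if "x \<in> X" for x
    using hf that homeo by (metis homeomorphism_def)
  then have h: "continuous_on X h"
    using homeo by (simp add: homeomorphism_def cong: continuous_on_cong)
  have in_X: "int_iterate X f k x \<in> X" if "x \<in> X" for k x
  proof -
    have "(f ^^ m) x \<in> X" "(h ^^ m) x \<in> X" for m
      using that hf by (induction m) auto
    then show ?thesis by (simp add: int_iterate_def h_def)
  qed
  have up: "int_iterate X f (k + 1) x = f (int_iterate X f k x)" if "x \<in> X" for k x
  proof (cases "0 \<le> k")
    case True
    then show ?thesis by (simp add: int_iterate_def nat_add_distrib)
  next
    case False
    then have "nat (- k) = Suc (nat (- (k + 1)))" by simp
    then have "int_iterate X f k x = h (int_iterate X f (k + 1) x)"
      using False by (auto simp: int_iterate_def h_def)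
    then show ?thesis using hf in_X that by simp
  qed
  have down: "int_iterate X f (k - 1) x = h (int_iterate X f k x)" if "x \<in> X" for k x
    using up[OF that, of "k - 1"] hf in_X that by simp
  have zero: "int_iterate X f 0 x = x" for x
    by (simp add: int_iterate_def)
  show ?thesis
  proof
    show "int_iterate X f (j + k) x = int_iterate X f j (int_iterate X f k x)" if "x \<in> X" for x j k
    proof (induction j rule: int_induct[where k = 0])
      case (step1 j)
      then show ?case using up[OF that, of "j + k"] up[OF in_X[OF that], of j] by (simp add: ac_simps)
    next
      case (step2 j)
      then show ?case using down[OF that, of "j + k"] down[OF in_X[OF that], of j]
        by (simp add: algebra_simps)
    qed (simp add: zero)
    show "continuous_on X (int_iterate X f k)" for k
    proof (induction k rule: int_induct[where k = 0])
      case base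
      then show ?case by (simp add: zero cong: continuous_on_cong)
    next
      case (step1 k)
      have "continuous_on X (\<lambda>x. f (int_iterate X f k x))"
        using continuous_on_compose2[OF f(1) step1(2)] in_X by blast
      then show ?case by (simp add: up cong: continuous_on_cong)
    next
      case (step2 k)
      have "continuous_on X (\<lambda>x. h (int_iterate X f k x))"
        using continuous_on_compose2[OF h step2(2)] in_X by blast
      then show ?case by (simp add: down cong: continuous_on_cong)
    qed
    show "finite {y \<in> X. \<forall>k. dist (int_iterate X f k x) (int_iterate X f k y) \<le> c}" if "x \<in> X" for x
      using assms(4)[OF that] by (simp add: dyn_ball_def)
    have one: "int_iterate X f 1 = f"
      by (simp add: int_iterate_def)
    show "\<exists>\<delta>>0. \<forall>x. range x \<subseteq> X \<longrightarrow> (\<forall>k. dist (int_iterate X f 1 (x k)) (x (k + 1)) < \<delta>) \<longrightarrow>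
        (\<exists>y\<in>X. \<forall>k. dist (int_iterate X f k y) (x k) < \<epsilon>)" if "0 < \<epsilon>" for \<epsilon>
      using \<open>shadowing X f\<close>[unfolded shadowing_def, rule_format, OF that]
      by (simp add: pseudo_orbit_def shadowed_def one image_subset_iff imp_conjL)
  qed (simp_all add: in_X zero assms)
qed

lemma filtercomap_abs_at_top: "filtercomap abs at_top = (sup at_top at_bot :: int filter)"
proof (rule filter_eqI)
  fix P :: "int \<Rightarrow> bool"
  have "(\<exists>Q. (\<exists>N. \<forall>n\<ge>N. Q n) \<and> (\<forall>k. Q \<bar>k\<bar> \<longrightarrow> P k)) \<longleftrightarrow> (\<exists>N. \<forall>n\<ge>N. P n) \<and> (\<exists>N. \<forall>n\<le>N. P n)"
  proof safe
    fix Q N assume "\<forall>n\<ge>N. Q n" "\<forall>k. Q \<bar>k\<bar> \<longrightarrow> P k"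
    then have "\<forall>n\<ge>N. P n" "\<forall>n\<le>- N. P n" by auto
    then show "\<exists>N. \<forall>n\<ge>N. P n" "\<exists>N. \<forall>n\<le>N. P n" by blast+
  next
    fix N M assume "\<forall>n\<ge>N. P n" "\<forall>n\<le>M. P n"
    then have "\<forall>n\<ge>max N (- M). P n \<and> P (- n)" by simp
    then show "\<exists>Q. (\<exists>N. \<forall>n\<ge>N. Q n) \<and> (\<forall>k. Q \<bar>k\<bar> \<longrightarrow> P k)"
      by (intro exI[of _ "\<lambda>k. P k \<and> P (- k)"] conjI exI[of _ "max N (- M)"])
        (auto simp: abs_if split: if_splits)
  qed
  then show "eventually P (filtercomap abs at_top) \<longleftrightarrow> eventually P (sup at_top at_bot)"
    by (simp add: eventually_filtercomap eventually_sup eventually_at_top_linorder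
        eventually_at_bot_linorder)
qed

lemma filterlim_filtercomap_abs_iff:
  "filterlim h F (filtercomap abs (at_top :: int filter)) \<longleftrightarrow> filterlim h F at_top \<and> filterlim h F at_bot"
  unfolding filtercomap_abs_at_top by (auto simp: filterlim_iff eventually_sup)

theorem theorem3:
  fixes X :: "'a::metric_space set" and f :: "'a \<Rightarrow> 'a" and n :: nat
  assumes "n \<ge> 1"
    and "compact X"
    and "\<exists>g. homeomorphism X X f g"
    and "n_expansive n X f"
    and "shadowing X f"
  shows "limit_shadowing X f \<and>
    (topologically_mixing X f \<longrightarrow> two_sided_limit_shadowing X f)"
proof -
  obtain c where "0 < c" "\<And>x. x \<in> X \<Longrightarrow> finite (dyn_ball X f x c)"
    using assms(4) by (auto simp: n_expansive_def)
  then interpret shadowing_action X "int_iterate X f" c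
    using assms shadowing_action_int_iterate by blast
  have one: "int_iterate X f 1 = f"
    by (simp add: int_iterate_def)
  have nonneg: "int_iterate X f (int k) = f ^^ k" for k
    by (simp add: int_iterate_def)
  have "limit_shadowed X f x" if "limit_pseudo_orbit X f x" for x
  proof -
    have x: "\<And>k. 1 \<le> k \<Longrightarrow> x k \<in> X" "(\<lambda>k. dist (f (x k)) (x (k + 1))) \<longlonglongrightarrow> 0"
      using that by (auto simp: limit_pseudo_orbit_def)
    \<comment> \<open>The value at index \<open>0\<close> is arbitrary, so the extension to negative times is
      constant from index \<open>1\<close> on downwards.\<close>
    define z where "z k = x (nat (max 1 k))" for k
    have "((\<lambda>k. dist (f (x (nat k))) (x (nat k + 1))) \<longlongrightarrow> 0) at_top"
      by (rule filterlim_compose[OF x(2) filterlim_nat_sequentially])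
    moreover have "\<forall>\<^sub>F k in at_top. dist (f (x (nat k))) (x (nat k + 1)) = dist (f (z k)) (z (k + 1))"
      using eventually_ge_at_top[of "1 :: int"]
      by eventually_elim (auto simp: z_def max_def nat_add_distrib)
    ultimately have "((\<lambda>k. dist (f (z k)) (z (k + 1))) \<longlongrightarrow> 0) at_top"
      by (rule Lim_transform_eventually)
    then obtain y where y: "y \<in> X" "((\<lambda>k. dist (int_iterate X f k y) (z k)) \<longlongrightarrow> 0) at_top"
      using limit_shadowing_at_top[of z] x(1) by (auto simp: z_def one image_subset_iff)
    have "(\<lambda>k. dist (int_iterate X f (int k) y) (z (int k))) \<longlonglongrightarrow> 0"
      by (rule filterlim_compose[OF y(2) filterlim_int_sequentially])
    moreover have "\<forall>\<^sub>F k in sequentially. dist (int_iterate X f (int k) y) (z (int k)) = dist ((f ^^ k) y) (x k)"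
      using eventually_ge_at_top[of "1 :: nat"]
      by eventually_elim (simp add: z_def max_def nonneg)
    ultimately have "(\<lambda>k. dist ((f ^^ k) y) (x k)) \<longlonglongrightarrow> 0"
      by (rule Lim_transform_eventually)
    with y(1) show ?thesis by (auto simp: limit_shadowed_def)
  qed
  moreover have "two_sided_limit_shadowed X f x"
    if mix: "topologically_mixing X f" and "two_sided_limit_pseudo_orbit X f x" for x
  proof -
    have x: "range x \<subseteq> X" "((\<lambda>k. dist (f (x k)) (x (k + 1))) \<longlongrightarrow> 0) at_top"
        "((\<lambda>k. dist (f (x k)) (x (k + 1))) \<longlongrightarrow> 0) at_bot"
      using that(2) unfolding two_sided_limit_pseudo_orbit_def filterlim_filtercomap_abs_iff by blast+
    have "\<exists>J. \<forall>j\<ge>J. int_iterate X f j ` U \<inter> V \<noteq> {}"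
      if "openin (top_of_set X) U" "U \<noteq> {}" "openin (top_of_set X) V" "V \<noteq> {}" for U V
    proof -
      have "\<exists>k\<ge>1. \<forall>j\<ge>k. (f ^^ j) ` U \<inter> V \<noteq> {}"
        by (rule mix[unfolded topologically_mixing_def, rule_format]) (intro conjI that)
      then obtain k where k: "\<forall>j\<ge>k. (f ^^ j) ` U \<inter> V \<noteq> {}"
        by (elim exE conjE)
      have "int_iterate X f j ` U \<inter> V \<noteq> {}" if "int k \<le> j" for j
        using k[rule_format, of "nat j"] nonneg[of "nat j"] that by simp
      then show ?thesis by (intro exI[of _ "int k"] allI impI)
    qed
    from two_sided_limit_shadowing_if_mixing[OF this, of x, unfolded one] x
    have "\<exists>y\<in>X. ((\<lambda>k. dist (int_iterate X f k y) (x k)) \<longlongrightarrow> 0) at_top \<and>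
        ((\<lambda>k. dist (int_iterate X f k y) (x k)) \<longlongrightarrow> 0) at_bot"
      by blast
    then show ?thesis
      unfolding two_sided_limit_shadowed_def filterlim_filtercomap_abs_iff .
  qed
  ultimately show ?thesis
    by (auto simp: limit_shadowing_def two_sided_limit_shadowing_def)
qed

end
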